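(* Let $a<b$ be real numbers, $I=[a,b]$, and let $0<L<b-a$. If $f:I\to\mathbb{R}$ is a periodic function with period $L$, then $\mathcal{T}_f$ is also a periodic function on $I$.
   Context: For a function $f:[a,b]\to\mathbb{R}$, the function $\mathcal{T}_f:[a,b]\to\mathbb{R}$ is defined by $\mathcal{T}_f(x)=f(a+b-x)$ for all $x\in[a,b]$. A function $g:I\to\mathbb{R}$ is periodic with period $L$, where $0<L<b-a$, if $g(x)=g(x+nL)$ for every $x\in I$ and every $n\in\mathbb{Z}$ with $x+nL\in I$; it is periodic if it is periodic with some period $L\in(0,b-a)$. *)

theory Defs
  imports Complex_Main
begin

(* A function [a,b] -> R is represented by a total function on the reals of which only
   the values on {a..b} matter. Periodicity inspects no other values, and the reflection
   on {a..b} uses only values of f on {a..b}, as x \<in> {a..b} implies a + b - x \<in> {a..b}. *)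

definition reflect_fun :: "real \<Rightarrow> real \<Rightarrow> (real \<Rightarrow> real) \<Rightarrow> real \<Rightarrow> real" where
  "reflect_fun a b f = (\<lambda>x. f (a + b - x))"

definition periodic_with :: "real \<Rightarrow> real \<Rightarrow> real \<Rightarrow> (real \<Rightarrow> real) \<Rightarrow> bool" where
  "periodic_with a b L g \<longleftrightarrow> 0 < L \<and> L < b - a \<and>
     (\<forall>x\<in>{a..b}. \<forall>n::int. x + of_int n * L \<in> {a..b} \<longrightarrow> g x = g (x + of_int n * L))"

definition periodic_fun_on :: "real \<Rightarrow> real \<Rightarrow> (real \<Rightarrow> real) \<Rightarrow> bool" where
  "periodic_fun_on a b g \<longleftrightarrow> (\<exists>L\<in>{0<..<b - a}. periodic_with a b L g)"

end

theory Submission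
  imports Defs
begin

text \<open>The reflection \<open>x \<mapsto> a + b - x\<close> maps \<open>{a..b}\<close> to itself and turns a
  shift by \<open>n * L\<close> into a shift by \<open>-n * L\<close>. Since periodicity allows shifts by negative
  multiples of the period, the reflected function keeps the same period \<open>L\<close>.\<close>

lemma periodic_with_reflect_fun:
  assumes "periodic_with a b L f"
  shows "periodic_with a b L (reflect_fun a b f)"
  unfolding periodic_with_def
proof (intro conjI ballI allI impI)
  show "0 < L" "L < b - a"
    using assms by (simp_all add: periodic_with_def)
next
  fix x :: real and n :: int
  assume x: "x \<in> {a..b}" and shifted: "x + of_int n * L \<in> {a..b}"
  have shift: "a + b - (x + of_int n * L) = (a + b - x) + of_int (- n) * L"
    by simp
  have "a + b - x \<in> {a..b}" "(a + b - x) + of_int (- n) * L \<in> {a..b}"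
    using x shifted by auto
  then have "f (a + b - x) = f ((a + b - x) + of_int (- n) * L)"
    using assms unfolding periodic_with_def by blast
  then show "reflect_fun a b f x = reflect_fun a b f (x + of_int n * L)"
    unfolding reflect_fun_def shift .
qed

theorem proposition2p2:
  fixes a b L :: real and f :: "real \<Rightarrow> real"
  assumes "a < b"
    and "0 < L" and "L < b - a"
    and "periodic_with a b L f"
  shows "periodic_fun_on a b (reflect_fun a b f)"
  unfolding periodic_fun_on_def
proof
  show "periodic_with a b L (reflect_fun a b f)"
    using assms(4) by (rule periodic_with_reflect_fun)
  show "L \<in> {0<..<b - a}"
    using assms(2,3) by simp
qed

end
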